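(* Let $d\ge2$. The characteristic function of a CCNC row partial isometry is not a complete unitary invariant: there exist CCNC row partial isometries $X_1,X_2$ (with $d$ components) which are not unitarily equivalent and yet have the same characteristic function, $b_{X_1}=b_{X_2}$ (as weak coincidence classes).
   Context: Hilbert spaces are complex and separable (or finite-dimensional); $\mathbb B^d$ is the open unit ball of $\mathbb C^d$; $\bigvee$ is closed linear span. For $z\in\mathbb B^d$, $z^*:\mathcal H\to\mathcal H\otimes\mathbb C^d$ is $z^*h=(\overline z_1h,\dots,\overline z_dh)^T$ and $z:=(z^* )^*$. A row partial isometry on $\mathcal H$ is a partial isometry $V=(V_1,\dots,V_d):\mathcal H\otimes\mathbb C^d\to\mathcal H$; $Vz^*=\sum\overline z_jV_j$. $V$ is CCNC if $\mathcal H=\bigvee_{z\in\mathbb B^d}(I-Vz^* )^{-1}\mathrm{Ran}(V)^\perp$. Row operators $X_1$ on $\mathcal H_1$, $X_2$ on $\mathcal H_2$ are unitarily equivalent if there is an onto isometry $U:\mathcal H_1\to\mathcal H_2$ with $UX_1=X_2(U\otimes I_d)$. Characteristic function. For a CCNC row partial isometry $V$ put $\mathcal R(V-z):=(V-z)\mathrm{Ker}(V)^\perp$. A model triple $(\gamma,\mathcal J_\infty,\mathcal J_0)$ for $V$ consists of Hilbert spaces with $\dim\mathcal J_\infty=\dim\mathrm{Ker}(V)$, $\dim\mathcal J_0=\dim\mathrm{Ran}(V)^\perp$, and a map $\gamma$ on $\mathbb B^d\cup\{\infty\}$ with $\gamma(z)\in\mathscr L(\mathcal J_0,\mathcal R(V-z)^\perp)$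 a linear isomorphism for each $z\in\mathbb B^d$, $\gamma(\infty)\in\mathscr L(\mathcal J_\infty,\mathrm{Ker}(V))$, and $\gamma(0),\gamma(\infty)$ onto isometries. Then $D^\gamma(z):=\gamma(z)^*\gamma(0)$ is invertible, and with $N^\gamma(z):=(\gamma(z)^*\otimes I_d)\gamma(\infty)$ one sets $b_V^\gamma(z):=D^\gamma(z)^{-1}zN^\gamma(z)\in\mathscr L(\mathcal J_\infty,\mathcal J_0)$. $b_1$ and $b_2$ with values in $\mathscr L(\mathcal H_1,\mathcal J_1)$ and $\mathscr L(\mathcal H_2,\mathcal J_2)$ coincide weakly if there is an onto isometry $U:\mathcal J_1\to\mathcal J_2$ with $Ub_1(z)b_1(w)^*U^*=b_2(z)b_2(w)^*$ for all $z,w\in\mathbb B^d$. The characteristic function $b_V$ is the weak coincidence class of $b_V^\gamma$ (independent of the model triple). *)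

theory Defs
  imports "HOL-Analysis.Analysis" "HOL-Library.Equipollence"
begin

section \<open>Complex separable Hilbert spaces\<close>

text \<open>
  A space is a record of a carrier and its operations, so that one may quantify over spaces.
  The inner product is linear in the first argument. Values of the operations, and of operators,
  at points outside the carriers are irrelevant.
\<close>

record 'a hspace =
  carrier :: "'a set"
  vadd :: "'a \<Rightarrow> 'a \<Rightarrow> 'a"
  vzero :: 'a
  smult :: "complex \<Rightarrow> 'a \<Rightarrow> 'a"
  ip :: "'a \<Rightarrow> 'a \<Rightarrow> complex"

definition vdiff :: "'a hspace \<Rightarrow> 'a \<Rightarrow> 'a \<Rightarrow> 'a" where
  "vdiff H x y = vadd H x (smult H (- 1) y)"

definition vnorm :: "'a hspace \<Rightarrow> 'a \<Rightarrow> real" where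
  "vnorm H x = sqrt (Re (ip H x x))"

text \<open>The locale \<open>Metric_space\<close> asks for nonnegativity and symmetry off the carrier too,
  hence the value 0 there.\<close>

definition vdist :: "'a hspace \<Rightarrow> 'a \<Rightarrow> 'a \<Rightarrow> real" where
  "vdist H x y = (if x \<in> carrier H \<and> y \<in> carrier H then vnorm H (vdiff H x y) else 0)"

definition vtopology :: "'a hspace \<Rightarrow> 'a topology" where
  "vtopology H = Metric_space.mtopology (carrier H) (vdist H)"

locale hilbert_space =
  fixes H :: "'a hspace"
  assumes zero_closed: "vzero H \<in> carrier H"
    and add_closed: "\<lbrakk>x \<in> carrier H; y \<in> carrier H\<rbrakk> \<Longrightarrow> vadd H x y \<in> carrier H"
    and smult_closed: "x \<in> carrier H \<Longrightarrow> smult H c x \<in> carrier H"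
    and add_assoc: "\<lbrakk>x \<in> carrier H; y \<in> carrier H; z \<in> carrier H\<rbrakk>
      \<Longrightarrow> vadd H (vadd H x y) z = vadd H x (vadd H y z)"
    and add_commute: "\<lbrakk>x \<in> carrier H; y \<in> carrier H\<rbrakk> \<Longrightarrow> vadd H x y = vadd H y x"
    and add_zero: "x \<in> carrier H \<Longrightarrow> vadd H x (vzero H) = x"
    and add_inverse: "x \<in> carrier H \<Longrightarrow> vadd H x (smult H (- 1) x) = vzero H"
    and smult_add_right: "\<lbrakk>x \<in> carrier H; y \<in> carrier H\<rbrakk>
      \<Longrightarrow> smult H c (vadd H x y) = vadd H (smult H c x) (smult H c y)"
    and smult_add_left: "x \<in> carrier H
      \<Longrightarrow> smult H (c + c') x = vadd H (smult H c x) (smult H c' x)"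
    and smult_assoc: "x \<in> carrier H \<Longrightarrow> smult H (c * c') x = smult H c (smult H c' x)"
    and smult_one: "x \<in> carrier H \<Longrightarrow> smult H 1 x = x"
    and ip_commute: "\<lbrakk>x \<in> carrier H; y \<in> carrier H\<rbrakk> \<Longrightarrow> ip H y x = cnj (ip H x y)"
    and ip_add: "\<lbrakk>x \<in> carrier H; y \<in> carrier H; z \<in> carrier H\<rbrakk>
      \<Longrightarrow> ip H (vadd H x y) z = ip H x z + ip H y z"
    and ip_smult: "\<lbrakk>x \<in> carrier H; y \<in> carrier H\<rbrakk> \<Longrightarrow> ip H (smult H c x) y = c * ip H x y"
    and ip_pos: "\<lbrakk>x \<in> carrier H; x \<noteq> vzero H\<rbrakk> \<Longrightarrow> Re (ip H x x) > 0"
    and complete: "Metric_space.mcomplete (carrier H) (vdist H)"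
    and separable: "separable_space (vtopology H)"

definition hsubspace :: "'a hspace \<Rightarrow> 'a set \<Rightarrow> bool" where
  "hsubspace H S \<longleftrightarrow> S \<subseteq> carrier H \<and> vzero H \<in> S \<and>
     (\<forall>x\<in>S. \<forall>y\<in>S. vadd H x y \<in> S) \<and> (\<forall>c. \<forall>x\<in>S. smult H c x \<in> S)"

definition closed_span :: "'a hspace \<Rightarrow> 'a set \<Rightarrow> 'a set" where
  "closed_span H S = (vtopology H) closure_of (hsubspace H hull S)"

definition sub_hspace :: "'a hspace \<Rightarrow> 'a set \<Rightarrow> 'a hspace" where
  "sub_hspace H S = H\<lparr>carrier := S\<rparr>"

definition ortho :: "'a hspace \<Rightarrow> 'a set \<Rightarrow> 'a set" where
  "ortho H S = {x \<in> carrier H. \<forall>y\<in>S. ip H x y = 0}"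

definition orthonormal_basis :: "'a hspace \<Rightarrow> 'a set \<Rightarrow> bool" where
  "orthonormal_basis H B \<longleftrightarrow> B \<subseteq> carrier H \<and>
     (\<forall>x\<in>B. \<forall>y\<in>B. ip H x y = (if x = y then 1 else 0)) \<and> closed_span H B = carrier H"

definition same_dim :: "'a hspace \<Rightarrow> 'b hspace \<Rightarrow> bool" where
  "same_dim H K \<longleftrightarrow> (\<exists>B C. orthonormal_basis H B \<and> orthonormal_basis K C \<and> B \<approx> C)"

text \<open>The space $H \otimes \mathbb{C}^d$, with $d$ the cardinality of \<open>'d\<close>, as columns of length $d$
  over $H$.\<close>

definition tensor :: "'a hspace \<Rightarrow> ('a ^ 'd::finite) hspace" where
  "tensor H = \<lparr>carrier = {x. \<forall>j. x $ j \<in> carrier H},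
     vadd = (\<lambda>x y. \<chi> j. vadd H (x $ j) (y $ j)),
     vzero = (\<chi> j. vzero H),
     smult = (\<lambda>c x. \<chi> j. smult H c (x $ j)),
     ip = (\<lambda>x y. \<Sum>j\<in>UNIV. ip H (x $ j) (y $ j))\<rparr>"

section \<open>Bounded operators\<close>

definition bounded_op :: "'a hspace \<Rightarrow> 'b hspace \<Rightarrow> ('a \<Rightarrow> 'b) \<Rightarrow> bool" where
  "bounded_op H K T \<longleftrightarrow>
     (\<forall>x\<in>carrier H. T x \<in> carrier K) \<and>
     (\<forall>x\<in>carrier H. \<forall>y\<in>carrier H. T (vadd H x y) = vadd K (T x) (T y)) \<and>
     (\<forall>c. \<forall>x\<in>carrier H. T (smult H c x) = smult K c (T x)) \<and>
     (\<exists>M. \<forall>x\<in>carrier H. vnorm K (T x) \<le> M * vnorm H x)"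

definition adj :: "'a hspace \<Rightarrow> 'b hspace \<Rightarrow> ('a \<Rightarrow> 'b) \<Rightarrow> 'b \<Rightarrow> 'a" where
  "adj H K T y = (THE x. x \<in> carrier H \<and> (\<forall>h\<in>carrier H. ip K (T h) y = ip H h x))"

definition tensor_op :: "('a \<Rightarrow> 'b) \<Rightarrow> 'a ^ 'd::finite \<Rightarrow> 'b ^ 'd" where
  "tensor_op T x = (\<chi> j. T (x $ j))"

definition kernel :: "'a hspace \<Rightarrow> 'b hspace \<Rightarrow> ('a \<Rightarrow> 'b) \<Rightarrow> 'a set" where
  "kernel H K T = {x \<in> carrier H. T x = vzero K}"

definition onto_isometry :: "'a hspace \<Rightarrow> 'b hspace \<Rightarrow> ('a \<Rightarrow> 'b) \<Rightarrow> bool" where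
  "onto_isometry H K U \<longleftrightarrow> bounded_op H K U \<and>
     (\<forall>x\<in>carrier H. vnorm K (U x) = vnorm H x) \<and> U ` carrier H = carrier K"

definition partial_isometry :: "'a hspace \<Rightarrow> 'b hspace \<Rightarrow> ('a \<Rightarrow> 'b) \<Rightarrow> bool" where
  "partial_isometry H K V \<longleftrightarrow> bounded_op H K V \<and>
     (\<forall>x\<in>ortho H (kernel H K V). vnorm K (V x) = vnorm H x)"

text \<open>The column $z^*$ and the row $z = (z^*)^*$.\<close>

definition zcol :: "'a hspace \<Rightarrow> complex ^ 'd::finite \<Rightarrow> 'a \<Rightarrow> 'a ^ 'd" where
  "zcol H z h = (\<chi> j. smult H (cnj (z $ j)) h)"

definition zrow :: "'a hspace \<Rightarrow> complex ^ 'd::finite \<Rightarrow> 'a ^ 'd \<Rightarrow> 'a" where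
  "zrow H z = adj H (tensor H) (zcol H z)"

section \<open>Row partial isometries\<close>

definition row_partial_isometry :: "'a hspace \<Rightarrow> ('a ^ 'd::finite \<Rightarrow> 'a) \<Rightarrow> bool" where
  "row_partial_isometry H V \<longleftrightarrow> hilbert_space H \<and> partial_isometry (tensor H) H V"

definition ran_perp :: "'a hspace \<Rightarrow> ('a ^ 'd::finite \<Rightarrow> 'a) \<Rightarrow> 'a set" where
  "ran_perp H V = ortho H (V ` carrier (tensor H))"

text \<open>For a row contraction \<open>V\<close> and \<open>z\<close> in the open unit ball, $I - Vz^*$ is a bijection of the
  carrier, so \<open>inv_into\<close> is its inverse.\<close>

definition resolvent :: "'a hspace \<Rightarrow> ('a ^ 'd::finite \<Rightarrow> 'a) \<Rightarrow> complex ^ 'd \<Rightarrow> 'a \<Rightarrow> 'a" where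
  "resolvent H V z = inv_into (carrier H) (\<lambda>h. vdiff H h (V (zcol H z h)))"

definition CCNC :: "'a hspace \<Rightarrow> ('a ^ 'd::finite \<Rightarrow> 'a) \<Rightarrow> bool" where
  "CCNC H V \<longleftrightarrow>
     carrier H = closed_span H (\<Union>z\<in>ball (0 :: complex ^ 'd) 1. resolvent H V z ` ran_perp H V)"

definition CCNC_row_partial_isometry :: "'a hspace \<Rightarrow> ('a ^ 'd::finite \<Rightarrow> 'a) \<Rightarrow> bool" where
  "CCNC_row_partial_isometry H V \<longleftrightarrow> row_partial_isometry H V \<and> CCNC H V"

definition row_unitarily_equivalent ::
  "'a hspace \<Rightarrow> ('a ^ 'd::finite \<Rightarrow> 'a) \<Rightarrow> 'b hspace \<Rightarrow> ('b ^ 'd \<Rightarrow> 'b) \<Rightarrow> bool" where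
  "row_unitarily_equivalent H1 X1 H2 X2 \<longleftrightarrow>
     (\<exists>U. onto_isometry H1 H2 U \<and> (\<forall>x\<in>carrier (tensor H1). U (X1 x) = X2 (tensor_op U x)))"

section \<open>The characteristic function\<close>

text \<open>The space $\mathcal{R}(V - z) = (V - z)\,\mathrm{Ker}(V)^\perp$.\<close>

definition R_space :: "'a hspace \<Rightarrow> ('a ^ 'd::finite \<Rightarrow> 'a) \<Rightarrow> complex ^ 'd \<Rightarrow> 'a set" where
  "R_space H V z =
     (\<lambda>x. vdiff H (V x) (zrow H z x)) ` ortho (tensor H) (kernel (tensor H) H V)"

text \<open>The value of $\gamma$ at infinity, whose domain and codomain differ from those of the other
  values, is the separate argument \<open>\<gamma>inf\<close>.\<close>

definition model_triple ::
  "'a hspace \<Rightarrow> ('a ^ 'd::finite \<Rightarrow> 'a) \<Rightarrow>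
   (complex ^ 'd \<Rightarrow> 'k \<Rightarrow> 'a) \<Rightarrow> ('j \<Rightarrow> 'a ^ 'd) \<Rightarrow> 'j hspace \<Rightarrow> 'k hspace \<Rightarrow> bool" where
  "model_triple H V \<gamma> \<gamma>inf Jinf J0 \<longleftrightarrow>
     hilbert_space Jinf \<and> hilbert_space J0 \<and>
     same_dim Jinf (sub_hspace (tensor H) (kernel (tensor H) H V)) \<and>
     same_dim J0 (sub_hspace H (ran_perp H V)) \<and>
     (\<forall>z\<in>ball 0 1.
        bounded_op J0 (sub_hspace H (ortho H (R_space H V z))) (\<gamma> z) \<and>
        bij_betw (\<gamma> z) (carrier J0) (ortho H (R_space H V z))) \<and>
     onto_isometry J0 (sub_hspace H (ortho H (R_space H V 0))) (\<gamma> 0) \<and>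
     onto_isometry Jinf (sub_hspace (tensor H) (kernel (tensor H) H V)) \<gamma>inf"

text \<open>In the next two definitions \<open>\<gamma> z\<close> is regarded as an operator into \<open>H\<close>, so that its adjoint can be
  applied to the values of \<open>\<gamma> 0\<close> and to the entries of the values of \<open>\<gamma>inf\<close>.\<close>

definition D_gamma :: "'a hspace \<Rightarrow> 'k hspace \<Rightarrow> (complex ^ 'd::finite \<Rightarrow> 'k \<Rightarrow> 'a) \<Rightarrow>
    complex ^ 'd \<Rightarrow> 'k \<Rightarrow> 'k" where
  "D_gamma H J0 \<gamma> z = adj J0 H (\<gamma> z) \<circ> \<gamma> 0"

definition N_gamma :: "'a hspace \<Rightarrow> 'k hspace \<Rightarrow> (complex ^ 'd::finite \<Rightarrow> 'k \<Rightarrow> 'a) \<Rightarrow>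
    ('j \<Rightarrow> 'a ^ 'd) \<Rightarrow> complex ^ 'd \<Rightarrow> 'j \<Rightarrow> 'k ^ 'd" where
  "N_gamma H J0 \<gamma> \<gamma>inf z = tensor_op (adj J0 H (\<gamma> z)) \<circ> \<gamma>inf"

definition b_gamma :: "'a hspace \<Rightarrow> 'k hspace \<Rightarrow> (complex ^ 'd::finite \<Rightarrow> 'k \<Rightarrow> 'a) \<Rightarrow>
    ('j \<Rightarrow> 'a ^ 'd) \<Rightarrow> complex ^ 'd \<Rightarrow> 'j \<Rightarrow> 'k" where
  "b_gamma H J0 \<gamma> \<gamma>inf z =
     inv_into (carrier J0) (D_gamma H J0 \<gamma> z) \<circ> zrow J0 z \<circ> N_gamma H J0 \<gamma> \<gamma>inf z"

text \<open>An operator-valued function on the ball comes with the spaces between which its values act.\<close>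

type_synonym ('j, 'k, 'd) op_fun = "'j hspace \<times> 'k hspace \<times> (complex ^ 'd \<Rightarrow> 'j \<Rightarrow> 'k)"

definition is_op_fun :: "('j, 'k, 'd::finite) op_fun \<Rightarrow> bool" where
  "is_op_fun = (\<lambda>(H, J, b). hilbert_space H \<and> hilbert_space J \<and>
     (\<forall>z\<in>ball 0 1. bounded_op H J (b z)))"

definition weakly_coincide ::
  "('j1, 'k1, 'd::finite) op_fun \<Rightarrow> ('j2, 'k2, 'd) op_fun \<Rightarrow> bool" where
  "weakly_coincide = (\<lambda>(H1, J1, b1) (H2, J2, b2).
     \<exists>U. onto_isometry J1 J2 U \<and>
       (\<forall>z\<in>ball 0 1. \<forall>w\<in>ball 0 1. \<forall>y\<in>carrier J2.
          U (b1 z (adj H1 J1 (b1 w) (adj J1 J2 U y))) = b2 z (adj H2 J2 (b2 w) y)))"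

text \<open>
  The weak coincidence class of the functions $b_V^\gamma$. The spaces of the model triples and of
  the members of the class have their points in the type \<open>'a\<close> of the points of \<open>H\<close>. This is no
  restriction: if \<open>H\<close> is not the zero space, then \<open>'a\<close> has at least the cardinality of the continuum,
  so every separable Hilbert space has an isomorphic copy there.
\<close>

definition characteristic_function ::
  "'a hspace \<Rightarrow> ('a ^ 'd::finite \<Rightarrow> 'a) \<Rightarrow> ('a, 'a, 'd) op_fun set" where
  "characteristic_function H V = {f. is_op_fun f \<and>
     (\<exists>\<gamma> \<gamma>inf (Jinf :: 'a hspace) (J0 :: 'a hspace). model_triple H V \<gamma> \<gamma>inf Jinf J0 \<and>
        weakly_coincide (Jinf, J0, b_gamma H J0 \<gamma> \<gamma>inf) f)}"

end

theory Submission
  imports Defs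
begin

text \<open>
  On \<open>\<complex>\<^sup>3\<close> with orthonormal basis \<open>e\<^sub>0, e\<^sub>1, e\<^sub>2\<close> let
  \<open>V x = \<langle>x, v\<^sub>1\<rangle> e\<^sub>1 + \<langle>x, v\<^sub>2\<rangle> e\<^sub>2\<close>, where \<open>v\<^sub>2 = e\<^sub>0 \<otimes> f\<^sub>j\<close>, \<open>v\<^sub>1 = a (e\<^sub>0 \<otimes> f\<^sub>i) + t u\<close>
  and \<open>u = e\<^sub>1 \<otimes> f\<^sub>j - a (e\<^sub>2 \<otimes> f\<^sub>i)\<close>; the relation between \<open>a\<close> and \<open>t\<close> says that \<open>v\<^sub>1\<close> is a unit vector.
  The vectors \<open>k\<^sub>z = (I - V z\<^sup>*)\<^sup>-\<^sup>1 e\<^sub>0\<close> are \<open>e\<^sub>0 + a z\<^sub>i\<^sup>* e\<^sub>1 + z\<^sub>j\<^sup>* e\<^sub>2\<close>, and \<open>u\<close> is orthogonal to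
  all \<open>z\<^sup>* k\<^sub>z\<close>. Hence the reflection in the hyperplane orthogonal to \<open>u\<close>, which replaces \<open>t\<close> by \<open>- t\<close>,
  changes neither \<open>k\<^sub>z\<close> nor the characteristic function, since \<open>\<gamma>(z)\<^sup>* z = (z\<^sup>* \<gamma>(z))\<^sup>*\<close> only sees
  the span of the \<open>z\<^sup>* k\<^sub>z\<close>. A unitary intertwining the two signs would have to satisfy
  \<open>t U e\<^sub>1 = - t U e\<^sub>1\<close>.
\<close>

section \<open>Metrics and isometries of spaces\<close>

text \<open>The triangle inequality and definiteness are inherited from the target of
  \<open>\<phi>\<close>. Nonnegativity and symmetry are also demanded off the carrier, where
  \<open>vdist\<close> is 0 by definition.\<close>

lemma Metric_space_of_embedding:
  fixes \<phi> :: "'a \<Rightarrow> 'b::metric_space"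
  assumes "inj_on \<phi> (carrier H)"
    and "\<And>x y. x \<in> carrier H \<Longrightarrow> y \<in> carrier H \<Longrightarrow> vdist H x y = dist (\<phi> x) (\<phi> y)"
  shows "Metric_space (carrier H) (vdist H)"
proof
  show "0 \<le> vdist H x y" for x y
  proof (cases "x \<in> carrier H \<and> y \<in> carrier H")
    case True
    then show ?thesis using assms(2) by simp
  qed (auto simp: vdist_def)
  show "vdist H x y = vdist H y x" for x y
  proof (cases "x \<in> carrier H \<and> y \<in> carrier H")
    case True
    then show ?thesis using assms(2) dist_commute[of "\<phi> x"] by metis
  qed (auto simp: vdist_def)
  show "(vdist H x y = 0) = (x = y)" if "x \<in> carrier H" "y \<in> carrier H" for x y
    using assms(2)[OF that] inj_on_eq_iff[OF assms(1) that] by simp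
  show "vdist H x z \<le> vdist H x y + vdist H y z"
    if "x \<in> carrier H" "y \<in> carrier H" "z \<in> carrier H" for x y z
    using that assms(2) by (simp add: dist_triangle)
qed

lemma sub_hspace_simps [simp]:
  "carrier (sub_hspace H S) = S" "vadd (sub_hspace H S) = vadd H"
  "vzero (sub_hspace H S) = vzero H" "smult (sub_hspace H S) = smult H"
  "ip (sub_hspace H S) = ip H" "vnorm (sub_hspace H S) = vnorm H"
  "vdiff (sub_hspace H S) = vdiff H"
  by (simp_all add: sub_hspace_def vnorm_def vdiff_def fun_eq_iff)

lemma Metric_space_sub_hspace:
  assumes "Metric_space (carrier H) (vdist H)" "S \<subseteq> carrier H"
  shows "Metric_space (carrier (sub_hspace H S)) (vdist (sub_hspace H S))"
proof -
  interpret Metric_space "carrier H" "vdist H" by fact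
  have eq: "vdist (sub_hspace H S) x y = vdist H x y" if "x \<in> S" "y \<in> S" for x y
    using that assms(2) by (auto simp: vdist_def)
  have off: "vdist (sub_hspace H S) x y = 0" if "\<not> (x \<in> S \<and> y \<in> S)" for x y
    using that by (auto simp: vdist_def)
  show ?thesis
  proof
    show "0 \<le> vdist (sub_hspace H S) x y" for x y
      using eq off nonneg by (metis order_refl)
    show "vdist (sub_hspace H S) x y = vdist (sub_hspace H S) y x" for x y
      using eq off commute by metis
    show "(vdist (sub_hspace H S) x y = 0) = (x = y)"
      if "x \<in> carrier (sub_hspace H S)" "y \<in> carrier (sub_hspace H S)" for x y
      using that assms(2) eq[of x y] zero[of x y] by (metis sub_hspace_simps(1) subsetD)
    show "vdist (sub_hspace H S) x z \<le> vdist (sub_hspace H S) x y + vdist (sub_hspace H S) y z"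
      if "x \<in> carrier (sub_hspace H S)" "y \<in> carrier (sub_hspace H S)"
        "z \<in> carrier (sub_hspace H S)" for x y z
      using that assms(2) eq triangle[of x y z] by auto
  qed
qed

lemma bounded_opD:
  assumes "bounded_op H K T" "x \<in> carrier H"
  shows "T x \<in> carrier K" and "T (smult H c x) = smult K c (T x)"
    and "y \<in> carrier H \<Longrightarrow> T (vadd H x y) = vadd K (T x) (T y)"
  using assms by (simp_all add: bounded_op_def)

lemma kernel_subset: "kernel H K T \<subseteq> carrier H"
  unfolding kernel_def by blast

text \<open>The definite description in \<open>adj\<close> depends only on the functional that sends
  \<open>h\<close> to \<open>ip K (T h) y\<close>, so two adjoints can be compared before it is
  known that either exists.\<close>

lemma adj_cong:
  assumes "\<And>h. h \<in> carrier H \<Longrightarrow> ip K (T h) y = ip K' (T' h) y'"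
  shows "adj H K T y = adj H K' T' y'"
  using assms unfolding adj_def by simp

text \<open>Transports the bases that witness \<open>same_dim\<close>. It is stated for bare metric
  structure, so that it applies directly to kernels regarded as subspaces.\<close>

lemma orthonormal_basis_image:
  assumes "Metric_space (carrier H) (vdist H)" "Metric_space (carrier K) (vdist K)"
    and sub: "hsubspace H (carrier H)"
    and U: "bounded_op H K U" "U (vzero H) = vzero K" "U ` carrier H = carrier K"
    and ip: "\<And>x y. x \<in> carrier H \<Longrightarrow> y \<in> carrier H \<Longrightarrow> ip K (U x) (U y) = ip H x y"
    and B: "orthonormal_basis H B"
  shows "orthonormal_basis K (U ` B)" and "inj_on U B"
proof -
  interpret MH: Metric_space "carrier H" "vdist H" by fact
  interpret MK: Metric_space "carrier K" "vdist K" by fact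
  note U_in = bounded_opD(1)[OF U(1)] and U_smult = bounded_opD(2)[OF U(1)]
    and U_add = bounded_opD(3)[OF U(1)]
  have closed: "\<And>x y. x \<in> carrier H \<Longrightarrow> y \<in> carrier H \<Longrightarrow> vadd H x y \<in> carrier H"
    "\<And>c x. x \<in> carrier H \<Longrightarrow> smult H c x \<in> carrier H"
    using sub by (simp_all add: hsubspace_def)
  have U_dist: "vdist K (U x) (U y) = vdist H x y" if "x \<in> carrier H" "y \<in> carrier H" for x y
  proof -
    have "U (vdiff H x y) = vdiff K (U x) (U y)"
      using that closed by (simp add: vdiff_def U_add U_smult)
    moreover have "vdiff H x y \<in> carrier H"
      using that closed by (simp add: vdiff_def)
    ultimately have "vnorm K (vdiff K (U x) (U y)) = vnorm H (vdiff H x y)"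
      using ip[of "vdiff H x y" "vdiff H x y"] by (simp add: vnorm_def)
    then show ?thesis using that U_in by (simp add: vdist_def)
  qed
  have BH: "B \<subseteq> carrier H" and span: "closed_span H B = carrier H"
    and on: "\<And>x y. x \<in> B \<Longrightarrow> y \<in> B \<Longrightarrow> ip H x y = (if x = y then 1 else 0)"
    using B by (auto simp: orthonormal_basis_def)
  have inj: "inj_on U (carrier H)"
    by (rule inj_onI) (metis U_dist U_in MH.zero MK.zero)
  then show "inj_on U B" using BH by (rule inj_on_subset)
  \<comment> \<open>The preimage under \<open>U\<close> of a subspace containing the image of
    \<open>B\<close> is itself a subspace containing \<open>B\<close>.\<close>
  have hull: "U y \<in> hsubspace K hull (U ` B)" if "y \<in> hsubspace H hull B" for y
    unfolding hull_def
  proof (rule InterI, clarify)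
    fix S assume S: "hsubspace K S" "U ` B \<subseteq> S"
    then have S': "vzero K \<in> S" "\<And>x y. x \<in> S \<Longrightarrow> y \<in> S \<Longrightarrow> vadd K x y \<in> S"
      "\<And>c x. x \<in> S \<Longrightarrow> smult K c x \<in> S" by (simp_all add: hsubspace_def)
    have "vzero H \<in> carrier H" using sub by (simp add: hsubspace_def)
    then have "hsubspace H {x \<in> carrier H. U x \<in> S}"
      unfolding hsubspace_def by (simp add: U(2) S' U_add U_smult closed)
    moreover have "B \<subseteq> {x \<in> carrier H. U x \<in> S}" using S BH by auto
    ultimately have "y \<in> {x \<in> carrier H. U x \<in> S}"
      using that hull_minimal[of B _ "hsubspace H"] by blast
    then show "U y \<in> S" by simp
  qed
  \<comment> \<open>Approximants of a preimage \<open>x\<close> are mapped to equally close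
    approximants of \<open>k\<close>, since \<open>U\<close> preserves distances.\<close>
  have "carrier K \<subseteq> closed_span K (U ` B)"
  proof
    fix k assume "k \<in> carrier K"
    then obtain x where x: "x \<in> carrier H" "k = U x" using U(3) by auto
    have "\<exists>y\<in>hsubspace K hull (U ` B). y \<in> MK.mball k r" if "r > 0" for r
    proof -
      obtain y where "y \<in> hsubspace H hull B" "y \<in> MH.mball x r"
        using span x(1) \<open>r > 0\<close> by (auto simp: closed_span_def vtopology_def MH.metric_closure_of)
      then show ?thesis
        using hull[of y] x U_dist U_in by (intro bexI[of _ "U y"]) auto
    qed
    then show "k \<in> closed_span K (U ` B)"
      using \<open>k \<in> carrier K\<close> by (auto simp: closed_span_def vtopology_def MK.metric_closure_of)
  qed
  moreover have "closed_span K (U ` B) \<subseteq> carrier K"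
    by (auto simp: closed_span_def vtopology_def MK.metric_closure_of)
  moreover have "U ` B \<subseteq> carrier K" using BH U_in by auto
  moreover have "ip K x y = (if x = y then 1 else 0)" if xy: "x \<in> U ` B" "y \<in> U ` B" for x y
  proof -
    obtain x' y' where "x' \<in> B" "y' \<in> B" "x = U x'" "y = U y'" using xy by auto
    moreover from this have "x' \<in> carrier H" "y' \<in> carrier H" using BH by auto
    ultimately show ?thesis
      using ip on inj_on_eq_iff[OF inj] by simp
  qed
  ultimately show "orthonormal_basis K (U ` B)"
    unfolding orthonormal_basis_def by blast
qed

section \<open>Nondegeneracy of the inner product and adjoints\<close>

context hilbert_space
begin

lemma ip_add_right:
  "\<lbrakk>x \<in> carrier H; y \<in> carrier H; z \<in> carrier H\<rbrakk> \<Longrightarrow> ip H x (vadd H y z) = ip H x y + ip H x z"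
  using ip_commute[of "vadd H y z" x] ip_commute[of y x] ip_commute[of z x]
  by (simp add: ip_add add_closed)

lemma ip_smult_right:
  "\<lbrakk>x \<in> carrier H; y \<in> carrier H\<rbrakk> \<Longrightarrow> ip H x (smult H c y) = cnj c * ip H x y"
  using ip_commute[of "smult H c y" x] ip_commute[of y x] by (simp add: ip_smult smult_closed)

text \<open>The difference \<open>d\<close> is orthogonal to itself, hence zero by
  definiteness.\<close>

lemma eq_if_ip_eq:
  assumes "x \<in> carrier H" "y \<in> carrier H" "\<And>h. h \<in> carrier H \<Longrightarrow> ip H h x = ip H h y"
  shows "x = y"
proof -
  define d where "d = vadd H x (smult H (- 1) y)"
  have d: "d \<in> carrier H" using assms by (simp add: d_def add_closed smult_closed)
  have "ip H d d = ip H d x - ip H d y"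
    using assms d by (subst (2) d_def) (simp add: ip_add_right ip_smult_right smult_closed)
  then have "d = vzero H" using ip_pos[of d] assms(3)[of d] d by auto
  then have "vadd H y d = y" using assms add_zero by simp
  moreover have "vadd H y d = vadd H x (vadd H y (smult H (- 1) y))"
    using assms unfolding d_def by (metis add_assoc add_commute smult_closed)
  ultimately show ?thesis using assms by (simp add: add_inverse add_zero)
qed

lemma smult_zero_left: "x \<in> carrier H \<Longrightarrow> smult H 0 x = vzero H"
  using smult_add_left[of x 1 "- 1"] by (simp add: smult_one add_inverse)

lemma adj_eqI:
  assumes "x \<in> carrier H" "\<And>h. h \<in> carrier H \<Longrightarrow> ip K (T h) y = ip H h x"
  shows "adj H K T y = x"
  unfolding adj_def
proof (rule the_equality)
  show "x \<in> carrier H \<and> (\<forall>h\<in>carrier H. ip K (T h) y = ip H h x)" using assms by auto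
  fix x' assume "x' \<in> carrier H \<and> (\<forall>h\<in>carrier H. ip K (T h) y = ip H h x')"
  then show "x' = x" using assms by (intro eq_if_ip_eq) auto
qed

text \<open>Riesz representation on a line, done by hand. It supplies the adjoints of the values of
  \<open>\<gamma>\<close>, whose domain turns out to be one-dimensional.\<close>

lemma adj_one_dim:
  assumes e: "e \<in> carrier H" "e \<noteq> vzero H"
    and span: "\<And>h. h \<in> carrier H \<Longrightarrow> \<exists>c. h = smult H c e"
    and T: "\<And>c. ip K (T (smult H c e)) g = c * ip K (T e) g"
  shows "adj H K T g \<in> carrier H"
    and "\<And>h. h \<in> carrier H \<Longrightarrow> ip K (T h) g = ip H h (adj H K T g)"
proof -
  \<comment> \<open>The coefficient is conjugated because the inner product is conjugate linear in
    its second argument.\<close>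
  define y where "y = smult H (cnj (ip K (T e) g / ip H e e)) e"
  have y: "y \<in> carrier H" using e by (simp add: y_def smult_closed)
  have "ip H e e \<noteq> 0" using ip_pos[OF e] by auto
  then have rep: "ip K (T h) g = ip H h y" if "h \<in> carrier H" for h
    using span[OF that] e by (auto simp: y_def T ip_smult ip_smult_right smult_closed)
  then have "adj H K T g = y" using y by (intro adj_eqI) auto
  then show "adj H K T g \<in> carrier H"
    "\<And>h. h \<in> carrier H \<Longrightarrow> ip K (T h) g = ip H h (adj H K T g)" using y rep by auto
qed

end

section \<open>Three-dimensional space\<close>

text \<open>A copy of three-dimensional complex space inside the sequences, the point type used in
  the theorem; the entries from index 3 on are fixed to 0.\<close>

definition space3 :: "(nat \<Rightarrow> complex) hspace" where
  "space3 = \<lparr>carrier = {f. \<forall>n\<ge>3. f n = 0},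
     vadd = (\<lambda>f g n. f n + g n), vzero = (\<lambda>n. 0), smult = (\<lambda>c f n. c * f n),
     ip = (\<lambda>f g. f 0 * cnj (g 0) + f 1 * cnj (g 1) + f 2 * cnj (g 2))\<rparr>"

definition vec3 :: "complex \<Rightarrow> complex \<Rightarrow> complex \<Rightarrow> nat \<Rightarrow> complex" where
  "vec3 x y z n = (if n = 0 then x else if n = 1 then y else if n = 2 then z else 0)"

lemma vec3_simps [simp]:
  "vec3 x y z 0 = x" "vec3 x y z (Suc 0) = y" "vec3 x y z 2 = z" "vec3 x y z \<in> carrier space3"
  by (auto simp: vec3_def space3_def)

lemma space3_simps [simp]:
  "vadd space3 f g = (\<lambda>n. f n + g n)" "vzero space3 = (\<lambda>n. 0)"
  "smult space3 c f = (\<lambda>n. c * f n)"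
  "ip space3 f g = f 0 * cnj (g 0) + f 1 * cnj (g 1) + f 2 * cnj (g 2)"
  by (simp_all add: space3_def)

lemma space3_eqI:
  assumes "f \<in> carrier space3" "g \<in> carrier space3" "f 0 = g 0" "f 1 = g 1" "f 2 = g 2"
  shows "f = g"
proof
  fix n :: nat
  consider "n = 0" | "n = 1" | "n = 2" | "n \<ge> 3" by linarith
  then show "f n = g n" using assms by cases (auto simp: space3_def)
qed

lemma space3_closed [simp]:
  "(\<lambda>n. 0) \<in> carrier space3"
  "f \<in> carrier space3 \<Longrightarrow> g \<in> carrier space3 \<Longrightarrow> (\<lambda>n. f n + g n) \<in> carrier space3"
  "f \<in> carrier space3 \<Longrightarrow> g \<in> carrier space3 \<Longrightarrow> (\<lambda>n. f n - g n) \<in> carrier space3"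
  "f \<in> carrier space3 \<Longrightarrow> (\<lambda>n. c * f n) \<in> carrier space3"
  by (auto simp: space3_def)

text \<open>The norm of the product type is Euclidean, so this is an isometry onto a complete
  separable space. Completeness and separability of \<open>space3\<close> are pulled back along it,
  with \<open>vec3\<close> as the inverse.\<close>

definition coords3 :: "(nat \<Rightarrow> complex) \<Rightarrow> complex \<times> complex \<times> complex" where
  "coords3 f = (f 0, f 1, f 2)"

lemma vnorm_space3: "vnorm space3 f = norm (coords3 f)"
  by (simp add: vnorm_def coords3_def norm_prod_def cmod_power2 flip: power2_eq_square)

lemma vdist_space3:
  assumes "f \<in> carrier space3" "g \<in> carrier space3"
  shows "vdist space3 f g = dist (coords3 f) (coords3 g)"
proof -
  have "coords3 (vdiff space3 f g) = coords3 f - coords3 g"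
    by (simp add: coords3_def vdiff_def)
  then show ?thesis using assms by (simp add: vdist_def vnorm_space3 dist_norm)
qed

lemma inj_on_coords3: "inj_on coords3 (carrier space3)"
  by (rule inj_onI) (auto simp: coords3_def intro: space3_eqI)

lemma coords3_vec3: "coords3 (vec3 x y z) = (x, y, z)"
  by (simp add: coords3_def)

lemma Metric_space_space3: "Metric_space (carrier space3) (vdist space3)"
  using inj_on_coords3 vdist_space3 by (rule Metric_space_of_embedding)

lemma mcomplete_space3: "Metric_space.mcomplete (carrier space3) (vdist space3)"
proof -
  interpret Metric_space "carrier space3" "vdist space3" by (rule Metric_space_space3)
  show ?thesis
    unfolding mcomplete_def
  proof (intro allI impI)
    fix s assume s: "MCauchy s"
    then have mem: "s n \<in> carrier space3" for n by (auto simp: MCauchy_def)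
    have "Cauchy (\<lambda>n. coords3 (s n))"
      using s mem by (simp add: MCauchy_def Cauchy_def vdist_space3)
    then obtain l where l: "(\<lambda>n. coords3 (s n)) \<longlonglongrightarrow> l"
      using Cauchy_convergent convergent_def by blast
    obtain x y z where "l = (x, y, z)" using prod_cases3 by blast
    then have "limitin mtopology s (vec3 x y z) sequentially"
      using l mem by (simp add: limit_metric_sequentially vdist_space3 coords3_vec3 lim_sequentially)
    then show "\<exists>f. limitin mtopology s f sequentially" by blast
  qed
qed

lemma separable_space3: "separable_space (vtopology space3)"
proof -
  interpret Metric_space "carrier space3" "vdist space3" by (rule Metric_space_space3)
  obtain D :: "(complex \<times> complex \<times> complex) set" where D: "countable D"
    "\<And>X. open X \<Longrightarrow> X \<noteq> {} \<Longrightarrow> \<exists>d\<in>D. d \<in> X"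
    using countable_dense_setE by blast
  define C where "C = (\<lambda>(x, y, z). vec3 x y z) ` D"
  have C: "C \<subseteq> carrier space3" "countable C" using D(1) by (auto simp: C_def)
  have "\<exists>g\<in>C. g \<in> mball f r" if "f \<in> carrier space3" "r > 0" for f r
  proof -
    obtain d where d: "d \<in> D" "d \<in> ball (coords3 f) r"
      using D(2)[of "ball (coords3 f) r"] \<open>r > 0\<close> by auto
    then have "(case d of (x, y, z) \<Rightarrow> vec3 x y z) \<in> mball f r"
      using that by (auto simp: vdist_space3 coords3_vec3 split: prod.split)
    then show ?thesis using d(1) by (auto simp: C_def)
  qed
  then have "vtopology space3 closure_of C = carrier space3"
    by (auto simp: vtopology_def metric_closure_of)
  then show ?thesis
    unfolding separable_space_def using C by (auto simp: vtopology_def)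
qed

lemma hilbert_space3: "hilbert_space space3"
proof
  fix x assume x: "x \<in> carrier space3" "x \<noteq> vzero space3"
  then have "coords3 x \<noteq> 0"
    using inj_on_eq_iff[OF inj_on_coords3 x(1), of "\<lambda>n. 0"] by (simp add: coords3_def zero_prod_def)
  then have "vnorm space3 x > 0" by (simp add: vnorm_space3)
  then show "Re (ip space3 x x) > 0" by (simp add: vnorm_def)
qed (auto simp: algebra_simps mcomplete_space3 separable_space3)

interpretation space3: hilbert_space space3 by (rule hilbert_space3)

section \<open>Columns over three-dimensional space\<close>

lemma tensor_space3_simps [simp]:
  "x \<in> carrier (tensor space3) \<longleftrightarrow> (\<forall>l. x $ l \<in> carrier space3)"
  "vadd (tensor space3) x y = (\<chi> l. (\<lambda>n. (x $ l) n + (y $ l) n))"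
  "vzero (tensor space3) = (\<chi> l. (\<lambda>n. 0))"
  "smult (tensor space3) c x = (\<chi> l. (\<lambda>n. c * (x $ l) n))"
  by (simp_all add: tensor_def)

lemma ip_tensor_space3: "ip (tensor space3) x y = (\<Sum>l\<in>UNIV. ip space3 (x $ l) (y $ l))"
  by (simp add: tensor_def)

lemma ip_tensor_space3_commute: "ip (tensor space3) y x = cnj (ip (tensor space3) x y)"
  by (simp add: ip_tensor_space3 algebra_simps)

lemma ip_tensor_space3_vdiff:
  "ip (tensor space3) x (vdiff (tensor space3) y z) =
     ip (tensor space3) x y - ip (tensor space3) x z"
  by (simp add: ip_tensor_space3 vdiff_def algebra_simps sum_subtractf sum.distrib sum_negf)

lemma Re_ip_tensor_space3: "Re (ip (tensor space3) x x) = (\<Sum>l\<in>UNIV. (norm (coords3 (x $ l)))\<^sup>2)"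
  by (simp add: ip_tensor_space3 norm_prod_def coords3_def cmod_power2 add.assoc flip: power2_eq_square)

lemma Metric_space_tensor_space3:
  "Metric_space (carrier (tensor space3 :: ((nat \<Rightarrow> complex) ^ 'd::finite) hspace)) (vdist (tensor space3))"
proof (rule Metric_space_of_embedding)
  let ?\<phi> = "\<lambda>x :: (nat \<Rightarrow> complex) ^ 'd. \<chi> l. coords3 (x $ l)"
  show "inj_on ?\<phi> (carrier (tensor space3))"
    by (rule inj_onI) (auto simp: vec_eq_iff inj_on_eq_iff[OF inj_on_coords3])
  fix x y :: "(nat \<Rightarrow> complex) ^ 'd"
  assume *: "x \<in> carrier (tensor space3)" "y \<in> carrier (tensor space3)"
  have "coords3 (vdiff (tensor space3) x y $ l) = (?\<phi> x - ?\<phi> y) $ l" for l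
    by (simp add: vdiff_def coords3_def)
  then have "vnorm (tensor space3) (vdiff (tensor space3) x y) = norm (?\<phi> x - ?\<phi> y)"
    unfolding vnorm_def Re_ip_tensor_space3 norm_vec_def L2_set_def by simp
  then show "vdist (tensor space3) x y = dist (?\<phi> x) (?\<phi> y)"
    using * by (simp add: vdist_def dist_norm)
qed

lemma zrow_space3:
  assumes x: "x \<in> carrier (tensor space3)"
  shows "zrow space3 z x = (\<lambda>n. \<Sum>l\<in>UNIV. z $ l * (x $ l) n)"
  unfolding zrow_def
proof (rule space3.adj_eqI)
  show "(\<lambda>n. \<Sum>l\<in>UNIV. z $ l * (x $ l) n) \<in> carrier space3"
    using x by (simp add: tensor_def) (simp add: space3_def)
  show "ip (tensor space3) (zcol space3 z h) x = ip space3 h (\<lambda>n. \<Sum>l\<in>UNIV. z $ l * (x $ l) n)" for h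
    by (simp add: ip_tensor_space3 zcol_def sum_distrib_left sum.distrib mult_ac)
qed

lemma ip_zrow_space3:
  assumes "x \<in> carrier (tensor space3)"
  shows "ip space3 (zrow space3 z x) h = ip (tensor space3) x (zcol space3 z h)"
  unfolding zrow_space3[OF assms]
  by (simp add: ip_tensor_space3 zcol_def sum_distrib_left sum.distrib mult_ac)

lemma zcol_space3 [simp]: "zcol space3 z h $ l = (\<lambda>n. cnj (z $ l) * h n)"
  by (simp add: zcol_def)

lemma zcol_closed: "h \<in> carrier space3 \<Longrightarrow> zcol space3 z h \<in> carrier (tensor space3)"
  by simp

section \<open>The row partial isometries and the reflection relating them\<close>

locale twisted_row =
  fixes i j :: "'d::finite" and a t :: real
  assumes ij: "i \<noteq> j" and a: "a \<noteq> 0" and t: "t \<noteq> 0" and a_t: "a\<^sup>2 + t\<^sup>2 * (1 + a\<^sup>2) = 1"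
begin

abbreviation E :: "(nat \<Rightarrow> complex) hspace" where "E \<equiv> space3"
abbreviation T :: "((nat \<Rightarrow> complex) ^ 'd) hspace" where "T \<equiv> tensor space3"

text \<open>\<open>twist\<close> and the coordinates of \<open>row\<close> are the inner products with the vectors \<open>u\<close>, \<open>v\<^sub>1\<close>, \<open>v\<^sub>2\<close> of the introduction; \<open>col\<close> is the adjoint of \<open>row\<close>.\<close>

definition twist :: "(nat \<Rightarrow> complex) ^ 'd \<Rightarrow> complex" where
  "twist x = (x $ j) 1 - a * (x $ i) 2"

definition row :: "(nat \<Rightarrow> complex) ^ 'd \<Rightarrow> nat \<Rightarrow> complex" where
  "row x = vec3 0 (a * (x $ i) 0 + t * twist x) ((x $ j) 0)"

definition col :: "(nat \<Rightarrow> complex) \<Rightarrow> (nat \<Rightarrow> complex) ^ 'd" where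
  "col y = (\<chi> l. if l = i then vec3 (of_real a * y 1) 0 (- (of_real (a * t) * y 1))
     else if l = j then vec3 (y 2) (of_real t * y 1) 0 else vec3 0 0 0)"

text \<open>The factor 2 divided by the squared norm of \<open>u\<close> in the formula for a
  reflection; \<open>u\<close> has the two nonzero entries 1 and \<open>- a\<close>.\<close>

definition refl_coeff :: real where
  "refl_coeff = 2 / (1 + a\<^sup>2)"

definition refl :: "(nat \<Rightarrow> complex) ^ 'd \<Rightarrow> (nat \<Rightarrow> complex) ^ 'd" where
  "refl x = (\<chi> l.
     if l = i then vec3 ((x $ i) 0) ((x $ i) 1) ((x $ i) 2 + refl_coeff * a * twist x)
     else if l = j then vec3 ((x $ j) 0) ((x $ j) 1 - refl_coeff * twist x) ((x $ j) 2) else x $ l)"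

definition kvec :: "complex ^ 'd \<Rightarrow> nat \<Rightarrow> complex" where
  "kvec z = vec3 1 (a * cnj (z $ i)) (cnj (z $ j))"

lemma a_t_complex: "(complex_of_real a)\<^sup>2 + (complex_of_real t)\<^sup>2 * (1 + (complex_of_real a)\<^sup>2) = 1"
  using arg_cong[OF a_t, of complex_of_real] by simp

lemma refl_coeff_complex: "complex_of_real refl_coeff * (1 + (complex_of_real a)\<^sup>2) = 2"
proof -
  have "1 + a\<^sup>2 \<noteq> 0" by (smt (verit) zero_le_power2)
  then have "refl_coeff * (1 + a\<^sup>2) = 2" by (metis nonzero_eq_divide_eq refl_coeff_def)
  then have "complex_of_real (refl_coeff * (1 + a\<^sup>2)) = 2" by simp
  then show ?thesis by simp
qed

text \<open>Keeps \<open>1 - t * cnj (z $ j)\<close> away from zero for \<open>z\<close> in the open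
  ball.\<close>

lemma abs_t_le: "\<bar>t\<bar> \<le> 1"
proof -
  have "t\<^sup>2 \<le> t\<^sup>2 * (1 + a\<^sup>2)" by (simp add: mult_left_mono distrib_left)
  then have "t\<^sup>2 \<le> 1" using a_t by (smt (verit) zero_le_power2)
  then show ?thesis by (simp add: abs_square_le_1)
qed

lemma ip_split:
  "ip T x y = ip E (x $ i) (y $ i) + ip E (x $ j) (y $ j) + (\<Sum>l\<in>- {i, j}. ip E (x $ l) (y $ l))"
proof -
  have "(\<Sum>l\<in>UNIV. ip E (x $ l) (y $ l)) =
      (\<Sum>l\<in>{i, j}. ip E (x $ l) (y $ l)) + (\<Sum>l\<in>- {i, j}. ip E (x $ l) (y $ l))"
    by (subst sum.union_disjoint[symmetric]) (auto intro: sum.cong)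
  also have "(\<Sum>l\<in>{i, j}. ip E (x $ l) (y $ l)) = ip E (x $ i) (y $ i) + ip E (x $ j) (y $ j)"
    using ij by simp
  finally show ?thesis unfolding ip_tensor_space3 .
qed

lemma row_closed [simp]: "row x \<in> carrier E" and col_closed [simp]: "col y \<in> carrier T"
  and kvec_closed [simp]: "kvec z \<in> carrier E"
  by (simp_all add: row_def col_def kvec_def)

lemma row_coords [simp]:
  "row x 0 = 0" "row x (Suc 0) = a * (x $ i) 0 + t * twist x" "row x 2 = (x $ j) 0"
  by (simp_all add: row_def)

lemma kvec_coords [simp]:
  "kvec z 0 = 1" "kvec z (Suc 0) = a * cnj (z $ i)" "kvec z 2 = cnj (z $ j)"
  by (simp_all add: kvec_def)

section \<open>The row is a partial isometry\<close>

lemma ip_row: "ip E (row x) y = ip T x (col y)"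
proof -
  have "(\<Sum>l\<in>- {i, j}. ip E (x $ l) (col y $ l)) = 0"
    by (rule sum.neutral) (auto simp: col_def)
  then show ?thesis
    using ij unfolding ip_split by (simp add: col_def twist_def algebra_simps)
qed

text \<open>The vectors \<open>v\<^sub>1\<close> and \<open>v\<^sub>2\<close> are orthonormal, so
  \<open>row\<close> after \<open>col\<close> is the orthogonal projection onto the coordinates 1
  and 2. The relation between \<open>a\<close> and \<open>t\<close> enters here.\<close>

lemma row_col: "row (col y) = vec3 0 (y 1) (y 2)"
proof -
  have "a * (col y $ i) 0 + t * twist (col y)
      = ((complex_of_real a)\<^sup>2 + (complex_of_real t)\<^sup>2 * (1 + (complex_of_real a)\<^sup>2)) * y 1"
    using ij by (simp add: col_def twist_def power2_eq_square algebra_simps)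
  then have "a * (col y $ i) 0 + t * twist (col y) = y 1" unfolding a_t_complex by simp
  moreover have "(col y $ j) 0 = y 2" using ij by (simp add: col_def)
  ultimately show ?thesis unfolding row_def by simp
qed

lemma row_col_row: "row (col (row x)) = row x"
  by (simp add: row_col) (simp add: row_def)

lemma row_linear:
  "row (vadd T x y) = vadd E (row x) (row y)" "row (smult T c x) = smult E c (row x)"
  by (rule space3_eqI; simp add: twist_def algebra_simps)+

lemma row_vdiff: "row (vdiff T x y) = vdiff E (row x) (row y)"
  unfolding vdiff_def row_linear ..

lemma vdiff_closed_T:
  "x \<in> carrier T \<Longrightarrow> y \<in> carrier T \<Longrightarrow> vdiff T x y \<in> carrier T"
  by (simp add: vdiff_def)

lemma kernelI: "x \<in> carrier T \<Longrightarrow> row x = vzero E \<Longrightarrow> x \<in> kernel T E row"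
  unfolding kernel_def by blast

lemma col_in_ortho_kernel: "col y \<in> ortho T (kernel T E row)"
proof -
  have "ip T (col y) x = 0" if "row x = vzero E" for x
    using ip_row[of x y] ip_tensor_space3_commute[of x "col y"] that by simp
  then show ?thesis using col_closed by (simp add: ortho_def kernel_def del: tensor_space3_simps)
qed

text \<open>The vector \<open>x - col (row x)\<close> lies in the kernel, so \<open>x\<close> is
  orthogonal to it; moving \<open>col\<close> across the inner product then gives the
  equality.\<close>

lemma row_isometric:
  assumes "x \<in> ortho T (kernel T E row)"
  shows "ip E (row x) (row x) = ip T x x"
proof -
  have "x \<in> carrier T" using assms unfolding ortho_def by blast
  moreover have "row (vdiff T x (col (row x))) = vzero E"
    unfolding row_vdiff row_col_row by (simp add: vdiff_def)
  ultimately have "vdiff T x (col (row x)) \<in> kernel T E row"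
    by (intro kernelI vdiff_closed_T col_closed)
  then have "ip T x (vdiff T x (col (row x))) = 0"
    using assms unfolding ortho_def by blast
  then show ?thesis by (simp only: ip_tensor_space3_vdiff ip_row right_minus_eq)
qed

text \<open>Pythagoras: the kernel component \<open>y\<close> has squared norm equal to the
  difference of the squared norms of \<open>x\<close> and \<open>row x\<close>.\<close>

lemma vnorm_row_le: "vnorm E (row x) \<le> vnorm T x"
proof -
  define y where "y = vdiff T x (col (row x))"
  have "ip T y y = ip T y x - ip T y (col (row x))"
    by (subst (2) y_def) (rule ip_tensor_space3_vdiff)
  also have "ip T y (col (row x)) = ip E (row y) (row x)" unfolding ip_row ..
  also have "row y = vzero E" unfolding y_def row_vdiff row_col_row by (simp add: vdiff_def)
  also have "ip T y x = cnj (ip T x y)" by (rule ip_tensor_space3_commute)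
  also have "ip T x y = ip T x x - ip E (row x) (row x)"
    unfolding y_def ip_tensor_space3_vdiff ip_row ..
  finally have "Re (ip T y y) = Re (ip T x x) - Re (ip E (row x) (row x))" by simp
  moreover have "Re (ip T y y) \<ge> 0" unfolding Re_ip_tensor_space3 by (simp add: sum_nonneg)
  ultimately show ?thesis by (simp add: vnorm_def)
qed

lemma partial_isometry_row: "partial_isometry T E row"
  unfolding partial_isometry_def bounded_op_def
proof (intro conjI ballI allI exI)
  show "vnorm E (row x) \<le> 1 * vnorm T x" for x using vnorm_row_le by simp
  show "vnorm E (row x) = vnorm T x" if "x \<in> ortho T (kernel T E row)" for x
    unfolding vnorm_def row_isometric[OF that] ..
qed (simp_all only: row_closed row_linear)

section \<open>The resolvent vectors and the spaces they span\<close>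

text \<open>Coordinate 2 of the equation determines \<open>h 2\<close> from \<open>h 0\<close>.
  Substituting it into coordinate 1 makes the factor \<open>1 - t * cnj (z $ j)\<close> split off on
  both sides, so that the solution does not depend on \<open>t\<close>.\<close>

lemma resolvent_equation:
  assumes "norm z < 1" and h: "h \<in> carrier E"
    and 1: "h 1 = row (zcol E z h) 1" and 2: "h 2 = row (zcol E z h) 2"
  shows "h = smult E (h 0) (kvec z)"
proof -
  have "norm (t * cnj (z $ j)) \<le> norm (z $ j)"
    using abs_t_le by (simp add: norm_mult mult_left_le_one_le)
  also have "\<dots> < 1" using assms(1) Finite_Cartesian_Product.norm_nth_le[of z j] by simp
  finally have "1 - t * cnj (z $ j) \<noteq> 0" by auto
  moreover have h2: "h 2 = cnj (z $ j) * h 0" using 2 by simp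
  moreover have "(1 - t * cnj (z $ j)) * (h 1 - a * cnj (z $ i) * h 0) = 0"
    using 1 h2 by (simp add: twist_def algebra_simps)
  ultimately have "h 1 = a * cnj (z $ i) * h 0" by simp
  then show ?thesis using h h2 by (intro space3_eqI) simp_all
qed

lemma kvec_equation:
  "row (zcol E z (smult E c (kvec z))) = vec3 0 (c * kvec z 1) (c * kvec z 2)"
  by (rule space3_eqI) (simp_all add: twist_def)

text \<open>A vector \<open>h\<close> is orthogonal to the space exactly when
  \<open>col h - zcol E z h\<close> lies in the kernel of \<open>row\<close>. By
  \<open>row_col\<close> this says that \<open>h\<close> and \<open>row (zcol E z h)\<close> agree
  in the coordinates 1 and 2, which is the equation solved by the multiples of
  \<open>kvec z\<close>.\<close>

lemma ortho_R_space:
  assumes "norm z < 1"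
  shows "ortho E (R_space E row z) = range (\<lambda>c. smult E c (kvec z))"
proof (intro equalityI subsetI)
  have R: "ip E (vdiff E (row x) (zrow E z x)) h = ip T x (vdiff T (col h) (zcol E z h))"
    if "x \<in> carrier T" for x h
  proof -
    have "ip E (vdiff E (row x) (zrow E z x)) h = ip E (row x) h - ip E (zrow E z x) h"
      by (simp add: vdiff_def algebra_simps)
    then show ?thesis unfolding ip_tensor_space3_vdiff ip_row ip_zrow_space3[OF that] .
  qed
  have row_D: "row (vdiff T (col h) (zcol E z h)) = vdiff E (vec3 0 (h 1) (h 2)) (row (zcol E z h))" for h
    unfolding row_vdiff row_col ..
  {
    fix h assume h: "h \<in> ortho E (R_space E row z)"
    \<comment> \<open>Testing \<open>h\<close> against the image of \<open>col x\<close> turns the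
      orthogonality relation into \<open>ip E x x = 0\<close>.\<close>
    define x where "x = row (vdiff T (col h) (zcol E z h))"
    have "vdiff E (row (col x)) (zrow E z (col x)) \<in> R_space E row z"
      unfolding R_space_def using col_in_ortho_kernel by blast
    then have "ip E h (vdiff E (row (col x)) (zrow E z (col x))) = 0"
      using h by (simp add: ortho_def)
    then have "ip E (vdiff E (row (col x)) (zrow E z (col x))) h = 0"
      by (subst (asm) complex_cnj_cancel_iff[symmetric]) (simp add: mult.commute)
    then have "ip T (col x) (vdiff T (col h) (zcol E z h)) = 0"
      by (simp only: R[OF col_closed])
    then have "ip T (vdiff T (col h) (zcol E z h)) (col x) = 0"
      by (subst ip_tensor_space3_commute) simp
    then have "ip E x x = 0" unfolding x_def ip_row .
    then have "x = vzero E" using space3.ip_pos[of x] by (auto simp: x_def)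
    then have "vdiff E (vec3 0 (h 1) (h 2)) (row (zcol E z h)) = vzero E"
      by (simp add: x_def row_D)
    then have "h 1 = row (zcol E z h) 1" "h 2 = row (zcol E z h) 2"
      by (auto simp: vdiff_def dest: fun_cong[of _ _ 1] fun_cong[of _ _ 2])
    then have "h = smult E (h 0) (kvec z)"
      using assms h by (intro resolvent_equation) (auto simp: ortho_def)
    then show "h \<in> range (\<lambda>c. smult E c (kvec z))" by blast
  }
  {
    fix h assume "h \<in> range (\<lambda>c. smult E c (kvec z))"
    then obtain c where h: "h = smult E c (kvec z)" by blast
    have hE: "h \<in> carrier E" using h by simp
    have "row (vdiff T (col h) (zcol E z h)) = vzero E"
      unfolding row_D unfolding h kvec_equation by (simp add: vdiff_def)
    then have ker: "vdiff T (col h) (zcol E z h) \<in> kernel T E row"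
      using hE by (intro kernelI vdiff_closed_T col_closed zcol_closed)
    have "ip E h y = 0" if y: "y \<in> R_space E row z" for y
    proof -
      obtain x where x: "x \<in> ortho T (kernel T E row)" "y = vdiff E (row x) (zrow E z x)"
        using y unfolding R_space_def by blast
      then have "ip E y h = ip T x (vdiff T (col h) (zcol E z h))"
        by (simp only: x(2), intro R) (simp add: ortho_def)
      also have "\<dots> = 0" using x(1) ker by (simp add: ortho_def)
      finally have "cnj (ip E y h) = 0" by simp
      then show ?thesis by (simp add: mult.commute)
    qed
    then show "h \<in> ortho E (R_space E row z)" using hE by (simp add: ortho_def)
  }
qed

lemma ran_perp_row: "ran_perp E row = range (\<lambda>c. smult E c (vec3 1 0 0))"
proof (intro equalityI subsetI)
  fix h assume h: "h \<in> ran_perp E row"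
  \<comment> \<open>Testing \<open>h\<close> against its own projection \<open>row (col h)\<close>
    gives the sum of the squared moduli of \<open>h 1\<close> and \<open>h 2\<close>.\<close>
  have "row (col h) \<in> row ` carrier T" using col_closed by (rule imageI)
  then have "ip E h (row (col h)) = 0"
    using h unfolding ran_perp_def ortho_def by blast
  then have "h 1 * cnj (h 1) + h 2 * cnj (h 2) = 0" unfolding row_col by simp
  then have "complex_of_real ((cmod (h 1))\<^sup>2 + (cmod (h 2))\<^sup>2) = 0"
    by (simp only: of_real_add complex_norm_square)
  then have "(cmod (h 1))\<^sup>2 + (cmod (h 2))\<^sup>2 = 0" unfolding of_real_eq_0_iff .
  then have "h 1 = 0" "h 2 = 0"
    using sum_power2_eq_zero_iff[of "cmod (h 1)" "cmod (h 2)"] by simp_all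
  moreover have "h \<in> carrier E" using h unfolding ran_perp_def ortho_def by blast
  ultimately have "h = smult E (h 0) (vec3 1 0 0)"
    by (intro space3_eqI) simp_all
  then show "h \<in> range (\<lambda>c. smult E c (vec3 1 0 0))" by blast
next
  fix h assume "h \<in> range (\<lambda>c. smult E c (vec3 1 0 0))"
  then obtain c where "h = smult E c (vec3 1 0 0)" by blast
  then have "h \<in> carrier E" "\<And>x. ip E h (row x) = 0" by simp_all
  then show "h \<in> ran_perp E row" by (simp only: ran_perp_def ortho_def mem_Collect_eq) blast
qed

lemma resolvent_kvec:
  assumes "norm z < 1"
  shows "resolvent E row z (vec3 1 0 0) = kvec z"
proof -
  let ?f = "\<lambda>h. vdiff E h (row (zcol E z h))"
  have "inj_on ?f (carrier E)"
  proof (rule inj_onI)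
    fix g h assume gh: "g \<in> carrier E" "h \<in> carrier E" "?f g = ?f h"
    \<comment> \<open>The difference solves the homogeneous equation
      \<open>d = row (zcol E z d)\<close>. Values of \<open>row\<close> vanish in coordinate 0, so
      \<open>d\<close> is 0 times \<open>kvec z\<close>.\<close>
    define d where "d = vdiff E g h"
    have "zcol E z d = vdiff T (zcol E z g) (zcol E z h)"
      by (simp add: d_def vdiff_def vec_eq_iff algebra_simps)
    then have row_d: "row (zcol E z d) = vdiff E (row (zcol E z g)) (row (zcol E z h))"
      by (simp only: row_vdiff)
    have "g n - h n = row (zcol E z g) n - row (zcol E z h) n" for n
      using fun_cong[OF gh(3), of n] by (simp add: vdiff_def algebra_simps)
    then have d: "d n = row (zcol E z d) n" for n
      unfolding row_d by (simp add: d_def vdiff_def)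
    have "d \<in> carrier E" using gh by (simp add: d_def vdiff_def)
    then have "d = smult E (d 0) (kvec z)"
      using d assms by (intro resolvent_equation) auto
    then have "d = (\<lambda>n. 0)" using d[of 0] by simp
    then show "g = h" by (auto simp: d_def vdiff_def fun_eq_iff)
  qed
  moreover have "?f (kvec z) = vec3 1 0 0"
    using kvec_equation[of z 1] by (intro space3_eqI) (simp_all add: vdiff_def)
  ultimately show ?thesis
    using inv_into_f_f[of ?f "carrier E" "kvec z"] unfolding resolvent_def by (simp only: kvec_closed)
qed

section \<open>Complete non-coisometry\<close>

text \<open>Three resolvent vectors already span: those at the origin and at half of the unit
  vectors in the directions \<open>i\<close> and \<open>j\<close>. The factor one half keeps the
  points inside the open ball.\<close>

lemma CCNC_row: "CCNC E row"
proof -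
  define S where "S = (\<Union>z\<in>ball (0 :: complex ^ 'd) 1. resolvent E row z ` ran_perp E row)"
  have kvec_S: "kvec z \<in> S" if "norm z < 1" for z
  proof -
    have "vec3 1 0 0 \<in> ran_perp E row"
      unfolding ran_perp_row by (rule range_eqI[of _ _ 1]) simp
    then show ?thesis
      unfolding S_def using that resolvent_kvec[OF that] by (auto intro!: bexI[of _ z] image_eqI)
  qed
  have norm_half: "norm (axis l (1 / 2) :: complex ^ 'd) < 1" for l
  proof -
    have "(norm ((axis l (1 / 2) :: complex ^ 'd) $ m))\<^sup>2 = (if m = l then 1 / 4 else 0)" for m
      by (simp add: axis_def power2_eq_square)
    then show ?thesis by (simp add: norm_vec_def L2_set_def real_sqrt_divide)
  qed
  have hull: "carrier E \<subseteq> hsubspace E hull S"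
  proof
    fix f assume f: "f \<in> carrier E"
    show "f \<in> hsubspace E hull S"
      unfolding hull_def
    proof (rule InterI, clarify)
      fix X assume X: "hsubspace E X" "S \<subseteq> X"
      define zi where "zi = axis i (1 / 2 :: complex)"
      define zj where "zj = axis j (1 / 2 :: complex)"
      have "kvec 0 \<in> X" "kvec zi \<in> X" "kvec zj \<in> X"
        using kvec_S X(2) norm_half by (auto simp: zi_def zj_def)
      \<comment> \<open>Here \<open>kvec zi\<close> and \<open>kvec zj\<close> differ from
        \<open>kvec 0\<close> by \<open>a / 2\<close> in coordinate 1 and by \<open>1 / 2\<close> in
        coordinate 2, respectively; this dictates the coefficients, with \<open>a\<close>
        nonzero.\<close>
      then have "vadd E (smult E (f 0 - 2 * f 1 / a - 2 * f 2) (kvec 0))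
          (vadd E (smult E (2 * f 1 / a) (kvec zi)) (smult E (2 * f 2) (kvec zj))) \<in> X" (is "?g \<in> X")
        using X(1) unfolding hsubspace_def by (simp del: space3_simps)
      moreover have "?g = f"
      proof (rule space3_eqI)
        show "?g \<in> carrier E"
          by (intro space3.add_closed space3.smult_closed kvec_closed)
      qed (use f a ij in \<open>simp_all add: zi_def zj_def axis_def\<close>)
      ultimately show "f \<in> X" by simp
    qed
  qed
  interpret Metric_space "carrier E" "vdist E" by (rule Metric_space_space3)
  have "carrier E = mtopology closure_of (hsubspace E hull S)"
  proof (intro equalityI subsetI)
    fix x assume x: "x \<in> carrier E"
    have "\<exists>y\<in>hsubspace E hull S. y \<in> mball x r" if "r > 0" for r
      using subsetD[OF hull x] centre_in_mball_iff[of x r] x that by (intro bexI[of _ x]) simp_all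
    then show "x \<in> mtopology closure_of (hsubspace E hull S)"
      unfolding metric_closure_of using x by blast
  next
    show "x \<in> carrier E" if "x \<in> mtopology closure_of (hsubspace E hull S)" for x
      using that unfolding metric_closure_of by blast
  qed
  then show ?thesis unfolding CCNC_def closed_span_def vtopology_def S_def .
qed

lemma CCNC_row_partial_isometry_row: "CCNC_row_partial_isometry E row"
  by (simp add: CCNC_row_partial_isometry_def row_partial_isometry_def hilbert_space3
      partial_isometry_row CCNC_row)

section \<open>Changing the sign of \<open>t\<close> by a reflection\<close>

interpretation mirror: twisted_row i j a "- t"
  using ij a t a_t by unfold_locales auto

text \<open>The reflection sends \<open>u\<close> to its negative, and \<open>twist\<close> is the
  inner product with \<open>u\<close>.\<close>

lemma twist_refl: "twist (refl x) = - twist x"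
proof -
  have "twist (refl x) = twist x - (refl_coeff * (1 + (complex_of_real a)\<^sup>2)) * twist x"
    using ij by (simp add: refl_def twist_def power2_eq_square algebra_simps)
  then show ?thesis unfolding refl_coeff_complex by simp
qed

lemma refl_nth:
  "refl x $ i = vec3 ((x $ i) 0) ((x $ i) 1) ((x $ i) 2 + refl_coeff * a * twist x)"
  "refl x $ j = vec3 ((x $ j) 0) ((x $ j) 1 - refl_coeff * twist x) ((x $ j) 2)"
  "l \<noteq> i \<Longrightarrow> l \<noteq> j \<Longrightarrow> refl x $ l = x $ l"
  using ij by (simp_all add: refl_def)

lemma refl_closed: "x \<in> carrier T \<Longrightarrow> refl x \<in> carrier T"
  by (simp add: refl_def)

lemma refl_refl:
  assumes "x \<in> carrier T"
  shows "refl (refl x) = x"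
proof -
  have x: "x $ l \<in> carrier E" for l using assms by simp
  have "refl (refl x) $ l = x $ l" for l
  proof -
    consider "l = i" | "l = j" | "l \<noteq> i" "l \<noteq> j" by blast
    then show ?thesis
    proof cases
      case 1
      then show ?thesis using x[of i] by (intro space3_eqI) (simp_all add: refl_nth twist_refl)
    next
      case 2
      then show ?thesis using x[of j] by (intro space3_eqI) (simp_all add: refl_nth twist_refl)
    next
      case 3
      then show ?thesis by (simp add: refl_nth)
    qed
  qed
  then show ?thesis by (simp add: vec_eq_iff)
qed

text \<open>Self-adjointness. Together with \<open>refl_refl\<close> it makes \<open>refl\<close>
  unitary, and it lets \<open>refl\<close> be moved onto a vector that it fixes.\<close>

lemma ip_refl: "ip T (refl x) y = ip T x (refl y)"
proof -
  have "(\<Sum>l\<in>- {i, j}. ip E (refl x $ l) (y $ l)) = (\<Sum>l\<in>- {i, j}. ip E (x $ l) (refl y $ l))"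
    by (rule sum.cong) (auto simp: refl_nth)
  then show ?thesis
    unfolding ip_split[of "refl x"] ip_split[of x "refl y"]
    by (simp add: refl_nth twist_def algebra_simps)
qed

lemma refl_smult: "refl (smult T c x) = smult T c (refl x)"
  by (auto simp: refl_def vec_eq_iff fun_eq_iff vec3_def twist_def algebra_simps)

lemma refl_vadd: "refl (vadd T x y) = vadd T (refl x) (refl y)"
  by (auto simp: refl_def vec_eq_iff fun_eq_iff vec3_def twist_def algebra_simps)

text \<open>The parameter \<open>t\<close> occurs in \<open>row\<close> only as the factor of
  \<open>twist\<close>, and \<open>refl\<close> leaves the entries of index 0 alone.\<close>

lemma mirror_row: "mirror.row x = row (refl x)"
  by (simp add: mirror.row_def row_def twist_refl) (simp add: refl_nth)

text \<open>The two terms of \<open>twist\<close> are both a multiple of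
  \<open>a * cnj (z $ i) * cnj (z $ j)\<close> and cancel: the vector is orthogonal to
  \<open>u\<close>.\<close>

lemma refl_zcol: "refl (zcol E z (smult E c (kvec z))) = zcol E z (smult E c (kvec z))"
proof -
  have "twist (zcol E z (smult E c (kvec z))) = 0"
    by (simp add: twist_def)
  then show ?thesis
    by (auto simp: refl_def vec_eq_iff fun_eq_iff vec3_def kvec_def)
qed

lemma refl_kernel:
  "refl ` kernel T E row = kernel T E mirror.row"
proof (intro equalityI subsetI)
  fix y assume "y \<in> refl ` kernel T E row"
  then obtain x where "x \<in> carrier T" "row x = vzero E" "y = refl x"
    unfolding kernel_def by blast
  then show "y \<in> kernel T E mirror.row"
    by (intro mirror.kernelI) (simp_all only: refl_closed mirror_row refl_refl)
next
  fix y assume "y \<in> kernel T E mirror.row"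
  then have y: "y \<in> carrier T" "row (refl y) = vzero E"
    unfolding kernel_def mirror_row by blast+
  then have "refl y \<in> kernel T E row" by (intro kernelI refl_closed)
  then show "y \<in> refl ` kernel T E row" using refl_refl[OF y(1)] by (metis imageI)
qed

lemma hsubspace_kernel: "hsubspace (sub_hspace T (kernel T E row)) (kernel T E row)"
proof -
  have "vzero T \<in> kernel T E row"
    by (rule kernelI) (simp_all add: row_def twist_def vec3_def fun_eq_iff)
  moreover have "vadd T x y \<in> kernel T E row"
    if "x \<in> kernel T E row" "y \<in> kernel T E row" for x y
    using that by (intro kernelI) (simp_all add: kernel_def row_linear[unfolded tensor_space3_simps])
  moreover have "smult T c x \<in> kernel T E row" if "x \<in> kernel T E row" for c x
    using that by (intro kernelI) (simp_all add: kernel_def row_linear[unfolded tensor_space3_simps])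
  ultimately show ?thesis unfolding hsubspace_def sub_hspace_simps by blast
qed

lemma vnorm_refl:
  assumes "x \<in> carrier T"
  shows "vnorm T (refl x) = vnorm T x"
  unfolding vnorm_def ip_refl refl_refl[OF assms] ..

text \<open>The basis of \<open>J\<close> is kept, and the basis of the kernel is carried over by
  \<open>refl\<close>, which is an isometry between the two kernels.\<close>

lemma same_dim_mirror:
  assumes "same_dim J (sub_hspace T (kernel T E row))"
  shows "same_dim J (sub_hspace T (kernel T E mirror.row))"
proof -
  let ?K = "sub_hspace T (kernel T E row)" and ?K' = "sub_hspace T (kernel T E mirror.row)"
  obtain B C where B: "orthonormal_basis J B" and C: "orthonormal_basis ?K C" and BC: "B \<approx> C"
    using assms by (auto simp: same_dim_def)
  have ker: "x \<in> carrier T" if "x \<in> kernel T E row" for x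
    using that by (rule subsetD[OF kernel_subset])
  have bdd: "bounded_op ?K ?K' refl"
    unfolding bounded_op_def sub_hspace_simps
  proof (intro conjI ballI allI exI)
    show "refl x \<in> kernel T E mirror.row" if "x \<in> kernel T E row" for x
      using that refl_kernel by blast
    show "vnorm T (refl x) \<le> 1 * vnorm T x" if "x \<in> kernel T E row" for x
      using vnorm_refl[OF ker[OF that]] by simp
  qed (simp_all only: refl_vadd refl_smult ker)
  have zero: "refl (vzero ?K) = vzero ?K'"
    by (simp add: refl_def twist_def vec3_def vec_eq_iff fun_eq_iff)
  have ip: "ip ?K' (refl x) (refl y) = ip ?K x y" if "x \<in> carrier ?K" "y \<in> carrier ?K" for x y
    using that ker by (simp only: sub_hspace_simps ip_refl refl_refl)
  have onto: "refl ` carrier ?K = carrier ?K'" using refl_kernel by simp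
  have sub: "hsubspace ?K (carrier ?K)" using hsubspace_kernel by simp
  note image = orthonormal_basis_image[OF
      Metric_space_sub_hspace[OF Metric_space_tensor_space3 kernel_subset]
      Metric_space_sub_hspace[OF Metric_space_tensor_space3 kernel_subset] sub bdd zero onto ip C]
  have "B \<approx> refl ` C"
    using BC inj_on_image_eqpoll_self[OF image(2)] eqpoll_sym eqpoll_trans by metis
  then show ?thesis unfolding same_dim_def using B image(1) by metis
qed

text \<open>Turns the value at infinity of a model triple for \<open>row\<close> into one for the
  mirrored row.\<close>

lemma onto_isometry_mirror:
  assumes J: "hilbert_space J" and U: "onto_isometry J (sub_hspace T (kernel T E row)) U"
  shows "onto_isometry J (sub_hspace T (kernel T E mirror.row))
    (\<lambda>x. if x \<in> carrier J then refl (U x) else U x)"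
proof -
  interpret J: hilbert_space J by fact
  have bdd: "bounded_op J (sub_hspace T (kernel T E row)) U"
    and norm: "\<And>x. x \<in> carrier J \<Longrightarrow> vnorm T (U x) = vnorm J x"
    and onto: "U ` carrier J = kernel T E row"
    using U by (simp_all add: onto_isometry_def)
  note D = bounded_opD[OF bdd, unfolded sub_hspace_simps]
  have ker: "U x \<in> carrier T" if "x \<in> carrier J" for x
    using D(1)[OF that] by (rule subsetD[OF kernel_subset])
  let ?U = "\<lambda>x. if x \<in> carrier J then refl (U x) else U x"
  have norm': "vnorm T (?U x) = vnorm J x" if "x \<in> carrier J" for x
    using that norm vnorm_refl[OF ker] by simp
  have "?U ` carrier J = refl ` U ` carrier J" by (auto simp: image_image)
  also have "\<dots> = kernel T E mirror.row" unfolding onto refl_kernel ..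
  finally have onto': "?U ` carrier J = kernel T E mirror.row" .
  have "bounded_op J (sub_hspace T (kernel T E mirror.row)) ?U"
    unfolding bounded_op_def sub_hspace_simps
  proof (intro conjI ballI allI exI)
    show "?U x \<in> kernel T E mirror.row" if "x \<in> carrier J" for x
      using that onto' by blast
    show "vnorm T (?U x) \<le> 1 * vnorm J x" if "x \<in> carrier J" for x
      using norm'[OF that] by simp
    show "?U (vadd J x y) = vadd T (?U x) (?U y)" if "x \<in> carrier J" "y \<in> carrier J" for x y
      by (simp only: that J.add_closed D(3) refl_vadd if_True)
    show "?U (smult J c x) = smult T c (?U x)" if "x \<in> carrier J" for c x
      by (simp only: that J.smult_closed D(2) refl_smult ker if_True)
  qed
  then show ?thesis
    unfolding onto_isometry_def sub_hspace_simps using norm' onto' by blast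
qed

section \<open>Invariance of the characteristic function\<close>

text \<open>Since \<open>\<gamma> z\<close> is a linear bijection onto the line through
  \<open>kvec z\<close>, the space \<open>J0\<close> is one-dimensional and
  \<open>adj_one_dim\<close> yields a genuine adjoint.\<close>

lemma adj_gamma:
  assumes "model_triple E row \<gamma> \<gamma>inf Jinf J0" and z: "norm z < 1"
  shows "adj J0 E (\<gamma> z) g \<in> carrier J0"
    and "\<And>h. h \<in> carrier J0 \<Longrightarrow> ip E (\<gamma> z h) g = ip J0 h (adj J0 E (\<gamma> z) g)"
    and "\<And>h. h \<in> carrier J0 \<Longrightarrow> \<exists>c. \<gamma> z h = smult E c (kvec z)"
proof -
  interpret J0: hilbert_space J0 using assms(1) by (simp add: model_triple_def)
  have "z \<in> ball 0 1" using z by simp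
  then have bdd: "bounded_op J0 (sub_hspace E (range (\<lambda>c. smult E c (kvec z)))) (\<gamma> z)"
    and bij: "bij_betw (\<gamma> z) (carrier J0) (range (\<lambda>c. smult E c (kvec z)))"
    using assms(1) \<open>z \<in> ball 0 1\<close>
    unfolding model_triple_def ortho_R_space[OF z, symmetric] by blast+
  note D = bounded_opD[OF bdd, unfolded sub_hspace_simps(1,4)]
  have "kvec z \<in> range (\<lambda>c. smult E c (kvec z))" by (rule range_eqI[of _ _ 1]) simp
  then obtain e where e: "e \<in> carrier J0" "\<gamma> z e = kvec z"
    using bij_betw_imp_surj_on[OF bij] by (metis imageE)
  \<comment> \<open>Coordinate 0 of \<open>kvec z\<close> is 1. By homogeneity of
    \<open>\<gamma> z\<close> the preimage \<open>e\<close> is therefore not the zero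
    vector.\<close>
  have "smult E 0 (kvec z) \<noteq> kvec z"
    by (auto dest: fun_cong[of _ _ 0])
  then have "e \<noteq> vzero J0"
    using D(2)[OF e(1), of 0] J0.smult_zero_left[OF e(1)] e(2) by metis
  moreover show img: "\<exists>c. \<gamma> z h = smult E c (kvec z)" if "h \<in> carrier J0" for h
    using D(1)[OF that] by blast
  moreover have "\<exists>c. h = smult J0 c e" if h: "h \<in> carrier J0" for h
  proof -
    obtain c where "\<gamma> z h = smult E c (kvec z)" using img[OF h] by blast
    then have "\<gamma> z h = \<gamma> z (smult J0 c e)" using D(2)[OF e(1)] e(2) by simp
    then show ?thesis
      using inj_onD[OF bij_betw_imp_inj_on[OF bij]] h J0.smult_closed[OF e(1)] by blast
  qed
  moreover have "ip E (\<gamma> z (smult J0 c e)) g = c * ip E (\<gamma> z e) g" for c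
    unfolding D(2)[OF e(1)] by (simp add: algebra_simps)
  ultimately show "adj J0 E (\<gamma> z) g \<in> carrier J0"
    "\<And>h. h \<in> carrier J0 \<Longrightarrow> ip E (\<gamma> z h) g = ip J0 h (adj J0 E (\<gamma> z) g)"
    using J0.adj_one_dim[of e E "\<gamma> z" g] e(1) by blast+
qed

text \<open>Pairing either side with \<open>h\<close> amounts to pairing with
  \<open>zcol E z (\<gamma> z h)\<close>. This is a multiple of the column of \<open>kvec z\<close>,
  which \<open>refl\<close> fixes, so \<open>refl\<close> can be absorbed.\<close>

lemma zrow_tensor_op_adj_refl:
  assumes mt: "model_triple E row \<gamma> \<gamma>inf Jinf J0" and z: "norm z < 1"
  shows "zrow J0 z (tensor_op (adj J0 E (\<gamma> z)) (refl x)) = zrow J0 z (tensor_op (adj J0 E (\<gamma> z)) x)"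
proof -
  interpret J0: hilbert_space J0 using mt by (simp add: model_triple_def)
  note A = adj_gamma[OF mt z]
  have ip: "ip (tensor J0) (zcol J0 z h) (tensor_op (adj J0 E (\<gamma> z)) y) = ip T (zcol E z (\<gamma> z h)) y"
    if h: "h \<in> carrier J0" for h y
  proof -
    have "ip (tensor J0) (zcol J0 z h) (tensor_op (adj J0 E (\<gamma> z)) y) =
        (\<Sum>l\<in>UNIV. cnj (z $ l) * ip E (\<gamma> z h) (y $ l))"
      by (simp only: tensor_def hspace.simps zcol_def tensor_op_def vec_lambda_beta
          J0.ip_smult[OF h A(1)] A(2)[OF h])
    also have "\<dots> = ip T (zcol E z (\<gamma> z h)) y"
      by (simp add: ip_tensor_space3 algebra_simps)
    finally show ?thesis .
  qed
  have "ip T (zcol E z (\<gamma> z h)) (refl x) = ip T (zcol E z (\<gamma> z h)) x" if h: "h \<in> carrier J0" for h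
  proof -
    obtain c where "\<gamma> z h = smult E c (kvec z)" using A(3)[OF h] by blast
    then show ?thesis by (simp only: ip_refl[symmetric] refl_zcol)
  qed
  then show ?thesis unfolding zrow_def by (intro adj_cong) (simp only: ip)
qed

text \<open>The model triple keeps its spaces and its values on the ball; only the value at infinity
  is composed with \<open>refl\<close>.\<close>

lemma characteristic_function_mirror:
  "characteristic_function E row \<subseteq> characteristic_function E mirror.row"
proof
  fix f assume "f \<in> characteristic_function E row"
  then obtain \<gamma> \<gamma>inf and Jinf J0 :: "(nat \<Rightarrow> complex) hspace"
    where f: "is_op_fun f" and mt: "model_triple E row \<gamma> \<gamma>inf Jinf J0"
      and wc: "weakly_coincide (Jinf, J0, b_gamma E J0 \<gamma> \<gamma>inf) f"
    unfolding characteristic_function_def by blast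
  define \<gamma>inf' where "\<gamma>inf' = (\<lambda>x. if x \<in> carrier Jinf then refl (\<gamma>inf x) else \<gamma>inf x)"
  \<comment> \<open>Both sides are the line through \<open>kvec z\<close>, whose definition does not
    involve \<open>t\<close>.\<close>
  have R: "ortho E (R_space E mirror.row z) = ortho E (R_space E row z)" if "norm z < 1" for z
    unfolding ortho_R_space[OF that] mirror.ortho_R_space[OF that] ..
  have ran: "ran_perp E mirror.row = ran_perp E row"
    unfolding ran_perp_row mirror.ran_perp_row ..
  have "onto_isometry Jinf (sub_hspace T (kernel T E mirror.row)) \<gamma>inf'"
    unfolding \<gamma>inf'_def using mt by (intro onto_isometry_mirror) (auto simp: model_triple_def)
  then have mt': "model_triple E mirror.row \<gamma> \<gamma>inf' Jinf J0"
    using mt same_dim_mirror[of Jinf] unfolding model_triple_def ran by (simp add: R dist_norm)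
  \<comment> \<open>The factor \<open>N_gamma\<close> may change, but \<open>zrow J0 z\<close>
    applied to it does not.\<close>
  have "b_gamma E J0 \<gamma> \<gamma>inf' z = b_gamma E J0 \<gamma> \<gamma>inf z" if "norm z < 1" for z
    by (rule ext) (simp add: b_gamma_def N_gamma_def \<gamma>inf'_def zrow_tensor_op_adj_refl[OF mt that])
  then have "weakly_coincide (Jinf, J0, b_gamma E J0 \<gamma> \<gamma>inf') f"
    using wc by (cases f) (simp add: weakly_coincide_def)
  then show "f \<in> characteristic_function E mirror.row"
    unfolding characteristic_function_def using f mt' by blast
qed

section \<open>Failure of unitary equivalence\<close>

text \<open>Two columns with a single nonzero entry suffice: the first confines the image
  \<open>u\<close> of the basis vector of index 1 to coordinate 1, and the second forces that
  coordinate to equal its own negative.\<close>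

lemma not_unitarily_equivalent_mirror:
  "\<not> row_unitarily_equivalent E row E mirror.row"
proof
  assume "row_unitarily_equivalent E row E mirror.row"
  then obtain U where iso: "onto_isometry E E U"
    and eq: "\<And>x. x \<in> carrier T \<Longrightarrow> U (row x) = mirror.row (tensor_op U x)"
    unfolding row_unitarily_equivalent_def by blast
  have bdd: "bounded_op E E U" and norm: "\<And>x. x \<in> carrier E \<Longrightarrow> vnorm E (U x) = vnorm E x"
    using iso by (auto simp: onto_isometry_def)
  note D = bounded_opD[OF bdd]
  define e :: "(nat \<Rightarrow> complex) \<Rightarrow> 'd \<Rightarrow> (nat \<Rightarrow> complex) ^ 'd" where
    "e f l = (\<chi> m. if m = l then f else (\<lambda>n. 0))" for f l
  have "U (\<lambda>n. 0) = (\<lambda>n. 0)" using D(2)[of "\<lambda>n. 0" 0] by simp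
  then have tensor_e: "tensor_op U (e f l) = e (U f) l" for f l
    by (simp add: tensor_op_def e_def vec_eq_iff)
  have e_closed: "e f l \<in> carrier T" if "f \<in> carrier E" for f l
    using that by (simp add: e_def)
  define u where "u = U (vec3 0 1 0)"
  have row_i: "row (e (vec3 1 0 0) i) = smult E a (vec3 0 1 0)"
    using ij by (intro space3_eqI) (simp_all add: e_def twist_def)
  have row_j: "row (e (vec3 0 1 0) j) = smult E t (vec3 0 1 0)"
    using ij by (intro space3_eqI) (simp_all add: e_def twist_def)
  have "smult E a u = U (row (e (vec3 1 0 0) i))"
    unfolding row_i u_def by (rule D(2)[symmetric]) simp
  also have "\<dots> = mirror.row (e (U (vec3 1 0 0)) i)"
    using eq[OF e_closed[of "vec3 1 0 0" i]] tensor_e by simp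
  finally have u1: "smult E a u = mirror.row (e (U (vec3 1 0 0)) i)" .
  \<comment> \<open>Coordinate 0 of a row value always vanishes, and coordinate 2 reads the entry at
    \<open>j\<close>, which is zero for a column supported at \<open>i\<close>.\<close>
  have "a * u 0 = 0" "a * u 2 = 0"
    using fun_cong[OF u1, of 0] fun_cong[OF u1, of 2] ij by (simp_all add: e_def)
  moreover have "smult E t u = U (row (e (vec3 0 1 0) j))"
    unfolding row_j u_def by (rule D(2)[symmetric]) simp
  then have u2: "smult E t u = mirror.row (e u j)"
    using eq[OF e_closed[of "vec3 0 1 0" j]] tensor_e unfolding u_def by simp
  \<comment> \<open>On a column supported at \<open>j\<close>, coordinate 1 of the mirrored row is
    \<open>- t\<close> times entry 1.\<close>
  have "t * u 1 = - (t * u 1)"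
    using fun_cong[OF u2, of 1] ij by (simp add: e_def twist_def)
  ultimately have "u 0 = 0" "u 1 = 0" "u 2 = 0" using a t by simp_all
  then have "vnorm E u = 0" by (simp add: vnorm_def)
  moreover have "vnorm E u = 1" unfolding u_def by (subst norm) (simp_all add: vnorm_def)
  ultimately show False by simp
qed

end

section \<open>A concrete pair of rows\<close>

theorem corollary4p21:
  assumes "CARD('d::finite) \<ge> 2"
  shows "\<exists>(H1 :: (nat \<Rightarrow> complex) hspace) (H2 :: (nat \<Rightarrow> complex) hspace)
          (X1 :: (nat \<Rightarrow> complex) ^ 'd \<Rightarrow> (nat \<Rightarrow> complex))
          (X2 :: (nat \<Rightarrow> complex) ^ 'd \<Rightarrow> (nat \<Rightarrow> complex)).
      CCNC_row_partial_isometry H1 X1 \<and> CCNC_row_partial_isometry H2 X2 \<and>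
      \<not> row_unitarily_equivalent H1 X1 H2 X2 \<and>
      characteristic_function H1 X1 = characteristic_function H2 X2"
proof -
  obtain i j :: 'd where ij: "i \<noteq> j"
    using assms by (metis card_2_iff' ex_card UNIV_I)
  \<comment> \<open>Any nonzero solution of the unit vector relation would do; here it reads 1/3 +
    1/2 * 4/3 = 1.\<close>
  define a :: real where "a = 1 / sqrt 3"
  define t :: real where "t = 1 / sqrt 2"
  interpret X1: twisted_row i j a t
    using ij by unfold_locales (simp_all add: a_def t_def power_divide)
  interpret X2: twisted_row i j a "- t"
    using ij by unfold_locales (simp_all add: a_def t_def power_divide)
  \<comment> \<open>The reverse inclusion is the same lemma applied to \<open>- t\<close>, whose
    mirror has parameter \<open>t\<close> again.\<close>
  have "characteristic_function space3 X1.row = characteristic_function space3 X2.row"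
    using X1.characteristic_function_mirror X2.characteristic_function_mirror by simp
  then show ?thesis
    using X1.CCNC_row_partial_isometry_row X2.CCNC_row_partial_isometry_row
      X1.not_unitarily_equivalent_mirror by blast
qed

end
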